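(* Let $I$ be a set, let $\mathbb{R}^{I}$ be equipped with the Tychonoff product topology, and let $X$ be a (nonempty) closed subset of $\mathbb{R}^{I}$, endowed with the subspace topology. Let $L$ be a truncated vector sublattice of $C(X)$ such that $\pi_{i}\in L$ for all $i\in I$, where $\pi_{i}$ is (the restriction to $X$ of) the projection $\mathbb{R}^{I}\to\mathbb{R}$, $(x_{j})_{j\in I}\mapsto x_{i}$. Then $X$ is $L$-realcompact.
   Context: $C(X)$ is the set of all real-valued continuous functions on $X$, with pointwise operations and order, so $(f\wedge g)(x)=\min\{f(x),g(x)\}$. $\mathbf{1}_{X}$ is the constant function $1$ on $X$. A truncated vector sublattice of $C(X)$ is a linear subspace $L$ of $C(X)$ closed under pointwise minimum and maximum and such that $f\wedge\mathbf{1}_{X}\in L$ for all $f\in L$ (it is not assumed that $\mathbf{1}_{X}\in L$). A truncation homomorphism on $L$ is a nonzero linear functional $\psi:L\to\mathbb{R}$ such that $\psi(f\wedge\mathbf{1}_{X})=\min\{\psi(f),1\}$ for all $f\in L$. $X$ is $L$-realcompact if for every truncation homomorphism $\psi$ on $L$ there exists $x\in X$ such that $\psi(f)=f(x)$ for all $f\in L$. *)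

theory Defs
  imports "HOL-Analysis.Analysis"
begin

text \<open>
  A function on a space \<open>X\<close> is represented by its extensional representative
  (\<open>undefined\<close> off \<open>topspace X\<close>), so that equality in HOL is equality of functions on \<open>X\<close>.
  The pointwise operations are therefore restricted to \<open>topspace X\<close>.
\<close>

definition cfuns :: "'a topology \<Rightarrow> ('a \<Rightarrow> real) set"
  where "cfuns X = {f \<in> extensional (topspace X). continuous_map X euclideanreal f}"

definition fplus :: "'a topology \<Rightarrow> ('a \<Rightarrow> real) \<Rightarrow> ('a \<Rightarrow> real) \<Rightarrow> 'a \<Rightarrow> real"
  where "fplus X f g = (\<lambda>x\<in>topspace X. f x + g x)"

definition fscale :: "'a topology \<Rightarrow> real \<Rightarrow> ('a \<Rightarrow> real) \<Rightarrow> 'a \<Rightarrow> real"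
  where "fscale X c f = (\<lambda>x\<in>topspace X. c * f x)"

definition fmin :: "'a topology \<Rightarrow> ('a \<Rightarrow> real) \<Rightarrow> ('a \<Rightarrow> real) \<Rightarrow> 'a \<Rightarrow> real"
  where "fmin X f g = (\<lambda>x\<in>topspace X. min (f x) (g x))"

definition fmax :: "'a topology \<Rightarrow> ('a \<Rightarrow> real) \<Rightarrow> ('a \<Rightarrow> real) \<Rightarrow> 'a \<Rightarrow> real"
  where "fmax X f g = (\<lambda>x\<in>topspace X. max (f x) (g x))"

definition fconst :: "'a topology \<Rightarrow> real \<Rightarrow> 'a \<Rightarrow> real"
  where "fconst X c = (\<lambda>x\<in>topspace X. c)"

definition truncated_vector_sublattice :: "'a topology \<Rightarrow> ('a \<Rightarrow> real) set \<Rightarrow> bool"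
  where "truncated_vector_sublattice X L \<longleftrightarrow>
    L \<subseteq> cfuns X \<and>
    fconst X 0 \<in> L \<and>
    (\<forall>f\<in>L. \<forall>g\<in>L. fplus X f g \<in> L) \<and>
    (\<forall>c. \<forall>f\<in>L. fscale X c f \<in> L) \<and>
    (\<forall>f\<in>L. \<forall>g\<in>L. fmin X f g \<in> L) \<and>
    (\<forall>f\<in>L. \<forall>g\<in>L. fmax X f g \<in> L) \<and>
    (\<forall>f\<in>L. fmin X f (fconst X 1) \<in> L)"

text \<open>
  A functional on \<open>L\<close> is a HOL function of which only the values on \<open>L\<close> matter.
\<close>

definition truncation_homomorphism ::
    "'a topology \<Rightarrow> ('a \<Rightarrow> real) set \<Rightarrow> (('a \<Rightarrow> real) \<Rightarrow> real) \<Rightarrow> bool"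
  where "truncation_homomorphism X L \<psi> \<longleftrightarrow>
    (\<forall>f\<in>L. \<forall>g\<in>L. \<psi> (fplus X f g) = \<psi> f + \<psi> g) \<and>
    (\<forall>c. \<forall>f\<in>L. \<psi> (fscale X c f) = c * \<psi> f) \<and>
    (\<exists>f\<in>L. \<psi> f \<noteq> 0) \<and>
    (\<forall>f\<in>L. \<psi> (fmin X f (fconst X 1)) = min (\<psi> f) 1)"

definition L_realcompact :: "'a topology \<Rightarrow> ('a \<Rightarrow> real) set \<Rightarrow> bool"
  where "L_realcompact X L \<longleftrightarrow>
    (\<forall>\<psi>. truncation_homomorphism X L \<psi> \<longrightarrow> (\<exists>x\<in>topspace X. \<forall>f\<in>L. \<psi> f = f x))"

end

theory Submission
  imports Defs
begin

text \<open>
  A truncation homomorphism \<open>\<psi>\<close> is positive and commutes with absolute values. Given finitely many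
  \<open>f \<in> L\<close> and \<open>\<epsilon> > 0\<close>, choose \<open>e \<in> L\<close> with \<open>\<psi> e = 2\<close> and put \<open>g = \<Sum>\<bar>f - \<psi> f \<cdot> (e \<and> 1)\<bar>\<close>, so that \<open>\<psi> g = 0\<close>.
  Then \<open>(e \<and> 2) - (e \<and> 1) - g / \<epsilon>\<close> has value \<open>1\<close> under \<open>\<psi>\<close>, hence is positive at some point \<open>y\<close>; there
  \<open>e y > 1\<close> and \<open>g y < \<epsilon>\<close>, i.e. \<open>\<bar>f y - \<psi> f\<bar> < \<epsilon>\<close> for all the given \<open>f\<close>. Applied to coordinate functions,
  this puts the point \<open>(\<psi> \<pi>\<^sub>i)\<^sub>i\<close> in the closure of \<open>X\<close>; applied to coordinate functions
  together with one \<open>f \<in> L\<close>, it shows that \<open>\<psi> f\<close> is the value of \<open>f\<close> there, by continuity.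
\<close>

locale truncation_hom =
  fixes X :: "'a topology" and L :: "('a \<Rightarrow> real) set" and \<psi> :: "('a \<Rightarrow> real) \<Rightarrow> real"
  assumes sublattice: "truncated_vector_sublattice X L"
    and hom: "truncation_homomorphism X L \<psi>"
begin

text \<open>
  Membership in \<open>L\<close> and the functional are transported to unrestricted functions, so that the
  ordinary pointwise operations can be used in place of the restricted ones.
\<close>

definition M :: "('a \<Rightarrow> real) set"
  where "M = {f. restrict f (topspace X) \<in> L}"

definition val :: "('a \<Rightarrow> real) \<Rightarrow> real"
  where "val f = \<psi> (restrict f (topspace X))"

section \<open>Linear structure and truncation for \<open>val\<close> on \<open>M\<close>\<close>

lemma restrict_mem: "f \<in> L \<Longrightarrow> restrict f (topspace X) = f"
  using sublattice
  by (auto simp: truncated_vector_sublattice_def cfuns_def intro!: extensional_restrict)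

lemma mem_M: "f \<in> L \<Longrightarrow> f \<in> M"
  by (simp add: M_def restrict_mem)

lemma val_eq: "f \<in> L \<Longrightarrow> val f = \<psi> f"
  by (simp add: val_def restrict_mem)

lemma val_cong: "(\<And>x. x \<in> topspace X \<Longrightarrow> f x = g x) \<Longrightarrow> val f = val g"
  unfolding val_def by (metis restrict_ext)

text \<open>Read from right to left, these turn restricted pointwise expressions into the operations
  for which the closure and homomorphism conditions are stated.\<close>

lemma lift_ops:
  "fplus X (restrict f (topspace X)) (restrict g (topspace X)) = (\<lambda>x\<in>topspace X. f x + g x)"
  "fscale X c (restrict f (topspace X)) = (\<lambda>x\<in>topspace X. c * f x)"
  "fmax X (restrict f (topspace X)) (restrict g (topspace X)) = (\<lambda>x\<in>topspace X. max (f x) (g x))"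
  "fmin X (restrict f (topspace X)) (fconst X 1) = (\<lambda>x\<in>topspace X. min (f x) 1)"
  by (auto simp: fplus_def fscale_def fmax_def fmin_def fconst_def)

lemma
  assumes "f \<in> M" "g \<in> M"
  shows add_M: "(\<lambda>x. f x + g x) \<in> M"
    and val_add: "val (\<lambda>x. f x + g x) = val f + val g"
    and max_M: "(\<lambda>x. max (f x) (g x)) \<in> M"
  using assms sublattice hom
  unfolding truncated_vector_sublattice_def truncation_homomorphism_def M_def val_def
  by (auto simp flip: lift_ops)

lemma
  assumes "f \<in> M"
  shows scale_M: "(\<lambda>x. c * f x) \<in> M"
    and val_scale: "val (\<lambda>x. c * f x) = c * val f"
    and min1_M: "(\<lambda>x. min (f x) 1) \<in> M"
    and val_min1: "val (\<lambda>x. min (f x) 1) = min (val f) 1"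
  using assms sublattice hom
  unfolding truncated_vector_sublattice_def truncation_homomorphism_def M_def val_def
  by (auto simp flip: lift_ops)

lemma
  shows zero_M: "(\<lambda>x. 0) \<in> M"
    and val_zero: "val (\<lambda>x. 0) = 0"
proof -
  have "restrict (\<lambda>x. 0) (topspace X) \<in> L"
    using sublattice by (simp add: truncated_vector_sublattice_def fconst_def)
  then show *: "(\<lambda>x. 0) \<in> M"
    by (simp add: M_def)
  show "val (\<lambda>x. 0) = 0"
    using val_scale[OF *, of 0] by simp
qed

lemma
  assumes "f \<in> M" "g \<in> M"
  shows diff_M: "(\<lambda>x. f x - g x) \<in> M"
    and val_diff: "val (\<lambda>x. f x - g x) = val f - val g"
  using add_M[OF assms(1) scale_M[OF assms(2), of "-1"]]
    val_add[OF assms(1) scale_M[OF assms(2), of "-1"]]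
    val_scale[OF assms(2), of "-1"]
  by simp_all

lemma
  assumes "finite A" "\<And>a. a \<in> A \<Longrightarrow> f a \<in> M"
  shows sum_M: "(\<lambda>x. \<Sum>a\<in>A. f a x) \<in> M"
    and val_sum: "val (\<lambda>x. \<Sum>a\<in>A. f a x) = (\<Sum>a\<in>A. val (f a))"
proof -
  have "(\<lambda>x. \<Sum>a\<in>A. f a x) \<in> M \<and> val (\<lambda>x. \<Sum>a\<in>A. f a x) = (\<Sum>a\<in>A. val (f a))"
    using assms by (induction A rule: finite_induct) (auto simp: zero_M val_zero add_M val_add)
  then show "(\<lambda>x. \<Sum>a\<in>A. f a x) \<in> M" "val (\<lambda>x. \<Sum>a\<in>A. f a x) = (\<Sum>a\<in>A. val (f a))"
    by auto
qed

section \<open>Positivity, truncation at other heights and absolute values\<close>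

text \<open>If \<open>val f\<close> were positive, some positive multiple of \<open>f\<close> would
  have value 2. Being nonpositive on the space, it is unchanged by truncation at 1, whereas its
  truncation has value \<open>min 2 1 = 1\<close>.\<close>

lemma val_nonpos:
  assumes f: "f \<in> M" and neg: "\<And>x. x \<in> topspace X \<Longrightarrow> f x \<le> 0"
  shows "val f \<le> 0"
proof (rule ccontr)
  assume "\<not> val f \<le> 0"
  then have pos: "val f > 0" by simp
  let ?c = "2 / val f"
  have "?c * f x \<le> 1" if "x \<in> topspace X" for x
    using mult_nonneg_nonpos[of ?c "f x"] neg[OF that] pos by simp
  then have "val (\<lambda>x. min (?c * f x) 1) = val (\<lambda>x. ?c * f x)"
    by (intro val_cong) simp
  then show False
    using val_min1[OF scale_M[OF f, of ?c]] val_scale[OF f, of ?c] pos by simp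
qed

lemma val_mono:
  assumes "f \<in> M" "g \<in> M" "\<And>x. x \<in> topspace X \<Longrightarrow> f x \<le> g x"
  shows "val f \<le> val g"
  using val_nonpos[OF diff_M[OF assms(1,2)]] val_diff[OF assms(1,2)] assms(3) by simp

text \<open>Truncation at height \<open>t\<close> is truncation at 1 conjugated by scaling with
  \<open>t\<close>.\<close>

lemma
  assumes f: "f \<in> M" and t: "t > 0"
  shows min_M: "(\<lambda>x. min (f x) t) \<in> M"
    and val_min: "val (\<lambda>x. min (f x) t) = min (val f) t"
proof -
  let ?g = "\<lambda>x. min (1 / t * f x) 1"
  have g: "?g \<in> M" and "val ?g = min (1 / t * val f) 1"
    using min1_M[OF scale_M[OF f, of "1 / t"]] val_min1[OF scale_M[OF f, of "1 / t"]]
      val_scale[OF f, of "1 / t"] by simp_all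
  moreover have "t * min (1 / t * y) 1 = min y t" for y
    using t by (simp add: min_def field_simps)
  ultimately show "(\<lambda>x. min (f x) t) \<in> M" "val (\<lambda>x. min (f x) t) = min (val f) t"
    using scale_M[OF g, of t] val_scale[OF g, of t] by simp_all
qed

lemma pos_part_M: "f \<in> M \<Longrightarrow> (\<lambda>x. max (f x) 0) \<in> M"
  by (rule max_M[OF _ zero_M])

text \<open>Positivity gives one inequality. For the other, \<open>f\<close> and its positive part
  have the same excess over every height \<open>t > 0\<close>, so truncation controls the value up
  to \<open>t\<close>, which is arbitrary.\<close>

lemma val_pos_part:
  assumes f: "f \<in> M"
  shows "val (\<lambda>x. max (f x) 0) = max (val f) 0"
proof (rule antisym)
  let ?p = "\<lambda>x. max (f x) 0"
  note p = pos_part_M[OF f]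
  show "max (val f) 0 \<le> val ?p"
    using val_mono[OF f p] val_mono[OF zero_M p] by (simp add: val_zero)
  show "val ?p \<le> max (val f) 0"
  proof (rule field_le_epsilon)
    fix t :: real assume t: "t > 0"
    \<comment> \<open>Both sides equal \<open>max (f x - t) 0\<close>.\<close>
    have *: "?p x - min (?p x) t = f x - min (f x) t" for x
      using t by (auto simp: max_def min_def)
    have "val ?p - min (val ?p) t = val f - min (val f) t"
      using val_diff[OF p min_M[OF p t]] val_diff[OF f min_M[OF f t]] val_min[OF p t] val_min[OF f t]
      unfolding * by simp
    then show "val ?p \<le> max (val f) 0 + t"
      using t by (auto simp: max_def min_def split: if_splits)
  qed
qed

lemma
  assumes f: "f \<in> M"
  shows abs_M: "(\<lambda>x. \<bar>f x\<bar>) \<in> M"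
    and val_abs: "val (\<lambda>x. \<bar>f x\<bar>) = \<bar>val f\<bar>"
proof -
  note p = scale_M[OF pos_part_M[OF f], of 2]
  have *: "\<bar>y\<bar> = 2 * max y 0 - y" for y :: real
    by (auto simp: max_def)
  show "(\<lambda>x. \<bar>f x\<bar>) \<in> M" "val (\<lambda>x. \<bar>f x\<bar>) = \<bar>val f\<bar>"
    using diff_M[OF p f] val_diff[OF p f] val_scale[OF pos_part_M[OF f]] val_pos_part[OF f]
    unfolding * by simp_all
qed

section \<open>Approximating finitely many values by evaluation at one point\<close>

text \<open>The value 2 makes the truncations at heights 2 and 1 differ in value by exactly
  1.\<close>

lemma obtain_unit:
  obtains e where "e \<in> M" "val e = 2"
proof -
  obtain f where f: "f \<in> L" "\<psi> f \<noteq> 0"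
    using hom unfolding truncation_homomorphism_def by blast
  then have "val (\<lambda>x. 2 / \<psi> f * f x) = 2"
    using val_scale[OF mem_M[OF f(1)], of "2 / \<psi> f"] val_eq[OF f(1)] by simp
  then show thesis
    using that scale_M[OF mem_M[OF f(1)]] by blast
qed

lemma approx_point_M:
  assumes A: "finite A" "A \<subseteq> M" and \<epsilon>: "\<epsilon> > 0"
  obtains y where "y \<in> topspace X" "\<And>f. f \<in> A \<Longrightarrow> \<bar>f y - val f\<bar> < \<epsilon>"
proof -
  obtain e where e: "e \<in> M" "val e = 2"
    by (rule obtain_unit)
  \<comment> \<open>\<open>e1\<close> stands in for the constant 1, which may be missing from
    \<open>M\<close>.\<close>
  define e1 where "e1 = (\<lambda>x. min (e x) 1)"
  have e1: "e1 \<in> M" "val e1 = 1"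
    using min1_M[OF e(1)] val_min1[OF e(1)] e(2) by (simp_all add: e1_def)
  define d where "d = (\<lambda>f x. \<bar>f x - val f * e1 x\<bar>)"
  have d: "d f \<in> M" "val (d f) = 0" if "f \<in> A" for f
  proof -
    have f: "f \<in> M" using that A by blast
    note df = diff_M[OF f scale_M[OF e1(1), of "val f"]]
    show "d f \<in> M" "val (d f) = 0"
      using abs_M[OF df] val_abs[OF df] val_diff[OF f scale_M[OF e1(1), of "val f"]]
        val_scale[OF e1(1), of "val f"] e1(2)
      by (simp_all add: d_def)
  qed
  define g where "g = (\<lambda>x. \<Sum>f\<in>A. d f x)"
  have g: "g \<in> M" "val g = 0"
    using sum_M[of A d] val_sum[of A d] A d by (simp_all add: g_def)
  have g_nonneg: "0 \<le> g x" for x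
    by (simp add: g_def d_def sum_nonneg)
  define u where "u = (\<lambda>x. min (e x) 2 - e1 x)"
  have u: "u \<in> M" "val u = 1"
    using diff_M[OF min_M[OF e(1)] e1(1), of 2] val_diff[OF min_M[OF e(1)] e1(1), of 2]
      val_min[OF e(1), of 2] e(2) e1(2) by (simp_all add: u_def)
  let ?h = "\<lambda>x. u x - 1 / \<epsilon> * g x"
  have "?h \<in> M" "val ?h = 1"
    using diff_M[OF u(1) scale_M[OF g(1), of "1 / \<epsilon>"]] val_diff[OF u(1) scale_M[OF g(1), of "1 / \<epsilon>"]]
      val_scale[OF g(1), of "1 / \<epsilon>"] u(2) g(2) by simp_all
  then obtain y where y: "y \<in> topspace X" "?h y > 0"
    using val_nonpos[of ?h] by force
  have "1 / \<epsilon> * g y \<ge> 0"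
    using g_nonneg[of y] \<epsilon> by simp
  with y(2) have "u y > 0" by linarith
  \<comment> \<open>Where \<open>e y <= 1\<close>, both truncations equal \<open>e y\<close> and
    \<open>u\<close> vanishes.\<close>
  then have e1y: "e1 y = 1"
    by (auto simp: u_def e1_def min_def split: if_splits)
  have "u y \<le> 1"
    by (simp add: u_def e1y)
  with y(2) have "1 / \<epsilon> * g y < 1" by linarith
  then have gy: "g y < \<epsilon>"
    using \<epsilon> by (simp add: field_simps)
  show thesis
  proof (rule that[OF y(1)])
    fix f assume "f \<in> A"
    then have "d f y \<le> g y"
      unfolding g_def by (intro member_le_sum) (auto simp: A d_def)
    then show "\<bar>f y - val f\<bar> < \<epsilon>"
      using gy by (simp add: d_def e1y)
  qed
qed

lemma approx_point:
  assumes "finite A" "A \<subseteq> L" "\<epsilon> > 0"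
  obtains y where "y \<in> topspace X" "\<And>f. f \<in> A \<Longrightarrow> \<bar>f y - \<psi> f\<bar> < \<epsilon>"
proof -
  have "A \<subseteq> M" using assms(2) mem_M by blast
  then obtain y where "y \<in> topspace X" "\<And>f. f \<in> A \<Longrightarrow> \<bar>f y - val f\<bar> < \<epsilon>"
    using approx_point_M[OF assms(1) _ assms(3)] by blast
  moreover have "val f = \<psi> f" if "f \<in> A" for f
    using that assms(2) val_eq by blast
  ultimately show thesis
    using that by metis
qed

end

section \<open>Neighbourhoods in real product spaces\<close>

text \<open>A basic open set constrains only finitely many coordinates, so the least of their radii
  serves for all of them.\<close>

lemma product_real_open_box:
  fixes x :: "'i \<Rightarrow> real"
  assumes U: "openin (product_topology (\<lambda>i. euclideanreal) I) U" "x \<in> U"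
  obtains J \<epsilon> where "finite J" "J \<subseteq> I" "\<epsilon> > 0"
    "\<And>y. y \<in> extensional I \<Longrightarrow> (\<And>i. i \<in> J \<Longrightarrow> \<bar>y i - x i\<bar> < \<epsilon>) \<Longrightarrow> y \<in> U"
proof -
  obtain B where B: "finite {i \<in> I. B i \<noteq> UNIV}" "\<And>i. i \<in> I \<Longrightarrow> open (B i)"
      "x \<in> Pi\<^sub>E I B" "Pi\<^sub>E I B \<subseteq> U"
    using U by (force simp: openin_product_topology_alt)
  let ?J = "{i \<in> I. B i \<noteq> UNIV}"
  have "\<exists>e>0. \<forall>z. \<bar>z - x i\<bar> < e \<longrightarrow> z \<in> B i" if "i \<in> ?J" for i
    using B(2)[of i] B(3) that by (auto simp: open_dist dist_real_def PiE_iff)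
  then obtain r where r: "\<And>i. i \<in> ?J \<Longrightarrow> r i > 0 \<and> (\<forall>z. \<bar>z - x i\<bar> < r i \<longrightarrow> z \<in> B i)"
    by metis
  \<comment> \<open>The inserted 1 keeps the minimum meaningful when no coordinate is
    constrained.\<close>
  define \<epsilon> where "\<epsilon> = Min (insert 1 (r ` ?J))"
  have pos: "\<epsilon> > 0"
    using B(1) r by (auto simp: \<epsilon>_def)
  have le: "\<epsilon> \<le> r i" if "i \<in> ?J" for i
    unfolding \<epsilon>_def using B(1) that by (intro Min_le) auto
  show thesis
  proof (rule that[of ?J \<epsilon>])
    fix y assume y: "y \<in> extensional I" "\<And>i. i \<in> ?J \<Longrightarrow> \<bar>y i - x i\<bar> < \<epsilon>"
    have "y i \<in> B i" if "i \<in> I" for i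
    proof (cases "B i = UNIV")
      case False
      then have i: "i \<in> ?J" using that by simp
      show ?thesis using r[OF i] y(2)[OF i] le[OF i] by auto
    qed simp
    then show "y \<in> U" using y(1) B(4) by (meson PiE_iff subsetD)
  qed (use B(1) pos in auto)
qed

theorem corollary4p3:
  fixes I :: "'i set" and X :: "('i \<Rightarrow> real) set" and L :: "(('i \<Rightarrow> real) \<Rightarrow> real) set"
  assumes "closedin (product_topology (\<lambda>i. euclideanreal) I) X"
    and "X \<noteq> {}"
    and "truncated_vector_sublattice (subtopology (product_topology (\<lambda>i. euclideanreal) I) X) L"
    and "\<And>i. i \<in> I \<Longrightarrow> (\<lambda>x\<in>X. x i) \<in> L"
  shows "L_realcompact (subtopology (product_topology (\<lambda>i. euclideanreal) I) X) L"
proof -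
  let ?P = "product_topology (\<lambda>i. euclideanreal) I"
  let ?X = "subtopology ?P X"
  have X_ext: "X \<subseteq> extensional I"
    using closedin_subset[OF assms(1)] by (auto simp: PiE_def)
  have top: "topspace ?X = X"
    using closedin_subset[OF assms(1)] by (rule topspace_subtopology_subset)
  have "\<exists>x\<in>topspace ?X. \<forall>f\<in>L. \<psi> f = f x" if hom: "truncation_homomorphism ?X L \<psi>" for \<psi>
  proof -
    interpret truncation_hom ?X L \<psi>
      using assms(3) hom by unfold_locales
    define \<pi> where "\<pi> = (\<lambda>i. \<lambda>x\<in>X. x i)"
    \<comment> \<open>Restricting to \<open>I\<close> makes \<open>x\<close> a point of the product,
      whose elements are extensional.\<close>
    define x where "x = (\<lambda>i\<in>I. \<psi> (\<pi> i))"
    \<comment> \<open>Membership in \<open>U\<close> follows from closeness in finitely many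
      coordinates, and these coordinate functions lie in \<open>L\<close>; they are approximated
      together with \<open>A\<close>.\<close>
    have near: "\<exists>y\<in>X \<inter> U. \<forall>f\<in>A. \<bar>f y - \<psi> f\<bar> < \<epsilon>"
      if U: "openin ?P U" "x \<in> U" and A: "finite A" "A \<subseteq> L" and \<epsilon>: "\<epsilon> > 0" for U A \<epsilon>
    proof -
      obtain J \<delta> where J: "finite J" "J \<subseteq> I" "\<delta> > 0"
        "\<And>y. y \<in> extensional I \<Longrightarrow> (\<And>i. i \<in> J \<Longrightarrow> \<bar>y i - x i\<bar> < \<delta>) \<Longrightarrow> y \<in> U"
        using product_real_open_box[OF U] by metis
      have "finite (A \<union> \<pi> ` J)" "A \<union> \<pi> ` J \<subseteq> L" "min \<epsilon> \<delta> > 0"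
        using A J assms(4) \<epsilon> by (auto simp: \<pi>_def)
      then obtain y where y: "y \<in> topspace ?X"
        and close: "\<And>f. f \<in> A \<union> \<pi> ` J \<Longrightarrow> \<bar>f y - \<psi> f\<bar> < min \<epsilon> \<delta>"
        using approx_point by metis
      have yX: "y \<in> X" using y top by simp
      have "\<bar>y i - x i\<bar> < \<delta>" if "i \<in> J" for i
        using close[of "\<pi> i"] that yX J(2) by (auto simp: x_def \<pi>_def)
      then have "y \<in> U"
        using J(4) yX X_ext by blast
      with yX close show ?thesis by force
    qed
    \<comment> \<open>With \<open>A\<close> empty, \<open>near\<close> says only that every
      neighbourhood of \<open>x\<close> meets \<open>X\<close>.\<close>
    have "x \<in> ?P closure_of X"
      using near[where A = "{}" and \<epsilon> = 1] by (auto simp: in_closure_of x_def)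
    then have xX: "x \<in> X"
      using assms(1) by (simp add: closure_of_closedin)
    have "\<psi> f = f x" if f: "f \<in> L" for f
    proof -
      have "continuous_map ?X euclideanreal f"
        using assms(3) f by (auto simp: truncated_vector_sublattice_def cfuns_def)
      \<comment> \<open>Half of the error is spent on continuity of \<open>f\<close> at
        \<open>x\<close>, half on \<open>near\<close>; the summand 0 fits the form of
        \<open>field_le_epsilon\<close>.\<close>
      have "\<bar>\<psi> f - f x\<bar> \<le> 0 + \<epsilon>" if \<epsilon>: "\<epsilon> > 0" for \<epsilon>
      proof -
        have "openin ?X {y \<in> topspace ?X. f y \<in> ball (f x) (\<epsilon> / 2)}"
          using \<open>continuous_map ?X euclideanreal f\<close> by (rule openin_continuous_map_preimage) simp
        then obtain U where U: "openin ?P U" "{y \<in> X. f y \<in> ball (f x) (\<epsilon> / 2)} = U \<inter> X"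
          unfolding top openin_subtopology by blast
        have "x \<in> {y \<in> X. f y \<in> ball (f x) (\<epsilon> / 2)}" using xX \<epsilon> by simp
        then have "x \<in> U" unfolding U(2) by (rule IntD1)
        then obtain y where y: "y \<in> X" "y \<in> U" "\<bar>f y - \<psi> f\<bar> < \<epsilon> / 2"
          using near[OF U(1), of "{f}" "\<epsilon> / 2"] f \<epsilon> by auto
        then have "y \<in> {y \<in> X. f y \<in> ball (f x) (\<epsilon> / 2)}"
          unfolding U(2) by blast
        then have "\<bar>f x - f y\<bar> < \<epsilon> / 2"
          by (simp add: dist_real_def)
        with y(3) show ?thesis by linarith
      qed
      then have "\<bar>\<psi> f - f x\<bar> \<le> 0" by (rule field_le_epsilon)
      then show ?thesis by simp
    qed
    then show ?thesis using xX top by blast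
  qed
  then show ?thesis by (simp add: L_realcompact_def)
qed

end
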